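(* Let $\alpha\in(0,\infty]$ and $X\in\mathcal X_\alpha$. Let $(X_n)_{n\in\mathbb N}$ be any sequence of real-valued random variables in $\mathcal X_\alpha$ such that $X_n\to X$ in distribution and the following uniform integrability condition holds: if $\alpha\in(0,\infty)$, then $\sup_n\mathsf E (X_n)_+^\alpha\,\mathsf I\{X_n>N\}\to0$ as $N\to\infty$; if $\alpha=\infty$, then $\sup_n\mathsf E e^{\lambda X_n}\,\mathsf I\{X_n>N\}\to0$ as $N\to\infty$ for each $\lambda\in\Lambda_X$. Then: (i) The convergence $$P_\alpha(X_n;x)\underset{n\to\infty}\longrightarrow P_\alpha(X;x)\qquad( * )$$ takes place for all real $x\ne x_*$; thus, $( * )$ holds for all real $x$ that are points of continuity of the function $P_\alpha(X;\cdot)$. (ii) The convergence $( * )$ holds for $x=x_*$ (when $x_*\in\mathbb R$) as well provided that $\mathsf P(X_n=x_* )\to\mathsf P(X=x_* )$ as $n\to\infty$. In particular, $( * )$ holds for $x=x_*$ if $\mathsf P(X=x_* )=0$.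
   Context: For real $u$, $u_+:=\max(0,u)$ and $u_+^\alpha:=(u_+)^\alpha$. Define $h_\alpha:\mathbb R\to\mathbb R$ by $h_\alpha(u)=(1+u/\alpha)_+^\alpha$ for $0<\alpha<\infty$, and $h_\infty(u)=e^u$. For a random variable $X$, $x\in\mathbb R$ and $\alpha\in(0,\infty]$ put $P_\alpha(X;x):=\inf_{\lambda\in(0,\infty)}\mathsf E\,h_\alpha(\lambda(X-x))$. For $\alpha\in(0,\infty)$, $\mathcal X_\alpha$ is the set of real-valued random variables $X$ with $\mathsf E X_+^\alpha<\infty$. Further, $\Lambda_X:=\{\lambda\in(0,\infty):\mathsf E e^{\lambda X}<\infty\}$, and $\mathcal X_\infty$ is the set of real-valued random variables $X$ with $\Lambda_X\ne\emptyset$. $x_*:=\sup\operatorname{supp}X\in(-\infty,\infty]$, where $\operatorname{supp}X$ is the support of the distribution of $X$. *)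

theory Defs
  imports "HOL-Probability.Probability"
begin

text \<open>The parameter \<open>\<alpha> \<in> (0, \<infinity>]\<close> is an \<^typ>\<open>ereal\<close>; all definitions below are used for \<open>\<alpha> > 0\<close>
  only. Expectations of nonnegative functions are Lebesgue integrals in \<open>[0, \<infinity>]\<close>
  (\<^typ>\<open>ennreal\<close>), so that they need not be finite.\<close>

definition h_fun :: "ereal \<Rightarrow> real \<Rightarrow> real" where
  "h_fun \<alpha> u =
     (if \<alpha> = \<infinity> then exp u
      else (max 0 (1 + u / real_of_ereal \<alpha>)) powr real_of_ereal \<alpha>)"

definition P_fun :: "ereal \<Rightarrow> 'a measure \<Rightarrow> ('a \<Rightarrow> real) \<Rightarrow> real \<Rightarrow> ennreal" where
  "P_fun \<alpha> M X x = (INF l\<in>{0<..}. \<integral>\<^sup>+\<omega>. ennreal (h_fun \<alpha> (l * (X \<omega> - x))) \<partial>M)"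

definition Lambda_set :: "'a measure \<Rightarrow> ('a \<Rightarrow> real) \<Rightarrow> real set" where
  "Lambda_set M X = {l. 0 < l \<and> (\<integral>\<^sup>+\<omega>. ennreal (exp (l * X \<omega>)) \<partial>M) < \<infinity>}"

definition X_class :: "ereal \<Rightarrow> 'a measure \<Rightarrow> ('a \<Rightarrow> real) set" where
  "X_class \<alpha> M = {X \<in> borel_measurable M.
     if \<alpha> = \<infinity> then Lambda_set M X \<noteq> {}
     else (\<integral>\<^sup>+\<omega>. ennreal ((max 0 (X \<omega>)) powr real_of_ereal \<alpha>) \<partial>M) < \<infinity>}"

definition rv_support :: "'a measure \<Rightarrow> ('a \<Rightarrow> real) \<Rightarrow> real set" where
  "rv_support M X =
     {t. \<forall>U. open U \<longrightarrow> t \<in> U \<longrightarrow> 0 < measure (distr M borel X) U}"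

definition x_star :: "'a measure \<Rightarrow> ('a \<Rightarrow> real) \<Rightarrow> ereal" where
  "x_star M X = Sup (ereal ` rv_support M X)"

definition unif_int_cond ::
  "ereal \<Rightarrow> 'a measure \<Rightarrow> ('a \<Rightarrow> real) \<Rightarrow> (nat \<Rightarrow> 'b measure) \<Rightarrow> (nat \<Rightarrow> 'b \<Rightarrow> real) \<Rightarrow> bool" where
  "unif_int_cond \<alpha> M X Mn Xn \<longleftrightarrow>
     (if \<alpha> = \<infinity> then
        \<forall>l\<in>Lambda_set M X.
          ((\<lambda>N::real. SUP n. \<integral>\<^sup>+\<omega>. ennreal (exp (l * Xn n \<omega>) * indicator {N<..} (Xn n \<omega>)) \<partial>Mn n)
             \<longlongrightarrow> 0) at_top
      else
        ((\<lambda>N::real. SUP n. \<integral>\<^sup>+\<omega>. ennreal ((max 0 (Xn n \<omega>)) powr real_of_ereal \<alpha>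
              * indicator {N<..} (Xn n \<omega>)) \<partial>Mn n)
             \<longlongrightarrow> 0) at_top)"

end

theory Submission
  imports Defs "HOL-Real_Asymp.Real_Asymp"
begin

text \<open>By Skorohod's representation one may assume \<open>X\<^sub>n \<rightarrow> X\<close> pointwise. For each fixed scale uniform
  integrability gives \<open>limsup E h\<^sub>\<alpha> (l (X\<^sub>n - x)) \<le> E h\<^sub>\<alpha> (l (X - x))\<close>, whence \<open>limsup P\<^sub>\<alpha> (X\<^sub>n; x) \<le> P\<^sub>\<alpha> (X; x)\<close>
  for every \<open>x\<close>. For \<open>x < x\<^sub>*\<close> the matching lower bound comes from a compactness argument on near-optimal
  scales together with Fatou's lemma. For \<open>x \<ge> x\<^sub>*\<close> one has \<open>P\<^sub>\<alpha> (X; x) = P (X = x)\<close>, while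
  \<open>P\<^sub>\<alpha> (X\<^sub>n; x) \<ge> P (X\<^sub>n = x)\<close> always.\<close>

section \<open>Weakly convergent laws\<close>

text \<open>Skorohod's theorem puts pointwise convergent copies of all the variables on one space,
  although the \<open>Mn n\<close> may differ. Equality of laws is recorded through integrals of
  Borel functions, since every expectation in the argument has that form.\<close>

lemma weak_conv_m_representation:
  fixes M :: "'a measure" and Mn :: "nat \<Rightarrow> 'b measure" and X :: "'a \<Rightarrow> real"
    and Xn :: "nat \<Rightarrow> 'b \<Rightarrow> real"
  assumes M: "prob_space M" "\<And>n. prob_space (Mn n)"
    and X [measurable]: "X \<in> borel_measurable M" "\<And>n. Xn n \<in> borel_measurable (Mn n)"
    and conv: "weak_conv_m (\<lambda>n. distr (Mn n) borel (Xn n)) (distr M borel X)"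
  obtains \<Omega> :: "real measure" and Yn Y where
    "prob_space \<Omega>" "\<And>n. Yn n \<in> borel_measurable \<Omega>" "Y \<in> borel_measurable \<Omega>"
    "\<And>n f. f \<in> borel_measurable borel \<Longrightarrow> (\<integral>\<^sup>+\<omega>. f (Xn n \<omega>) \<partial>Mn n) = (\<integral>\<^sup>+\<omega>. f (Yn n \<omega>) \<partial>\<Omega>)"
    "\<And>f. f \<in> borel_measurable borel \<Longrightarrow> (\<integral>\<^sup>+\<omega>. f (X \<omega>) \<partial>M) = (\<integral>\<^sup>+\<omega>. f (Y \<omega>) \<partial>\<Omega>)"
    "\<And>\<omega>. \<omega> \<in> space \<Omega> \<Longrightarrow> (\<lambda>n. Yn n \<omega>) \<longlonglongrightarrow> Y \<omega>"
proof -
  have "real_distribution (distr (Mn n) borel (Xn n))" for n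
    using M(2) X(2) by (simp add: prob_space.real_distribution_distr)
  moreover have "real_distribution (distr M borel X)"
    using M(1) X(1) by (simp add: prob_space.real_distribution_distr)
  ultimately obtain \<Omega> :: "real measure" and Yn Y where \<Omega>: "prob_space \<Omega>"
    and Yn: "\<And>n. Yn n \<in> borel_measurable \<Omega>"
    and dn: "\<And>n. distr \<Omega> borel (Yn n) = distr (Mn n) borel (Xn n)"
    and "Y \<in> measurable \<Omega> lborel" and d: "distr \<Omega> borel Y = distr M borel X"
    and lim: "\<And>\<omega>. \<omega> \<in> space \<Omega> \<Longrightarrow> (\<lambda>n. Yn n \<omega>) \<longlonglongrightarrow> Y \<omega>"
    using Skorohod[OF _ _ conv] by blast
  then have Y: "Y \<in> borel_measurable \<Omega>" by simp
  show ?thesis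
  proof (rule that[OF \<Omega> Yn Y _ _ lim])
    show "(\<integral>\<^sup>+\<omega>. f (Xn n \<omega>) \<partial>Mn n) = (\<integral>\<^sup>+\<omega>. f (Yn n \<omega>) \<partial>\<Omega>)"
      if "f \<in> borel_measurable borel" for n f
      using nn_integral_distr[OF Yn[of n], of f] nn_integral_distr[OF X(2)[of n], of f] dn[of n] that
      by simp
    show "(\<integral>\<^sup>+\<omega>. f (X \<omega>) \<partial>M) = (\<integral>\<^sup>+\<omega>. f (Y \<omega>) \<partial>\<Omega>)"
      if "f \<in> borel_measurable borel" for f
      using nn_integral_distr[OF Y, of f] nn_integral_distr[OF X(1), of f] d that
      by simp
  qed
qed

text \<open>Fatou's lemma applied to the Skorohod copies. The integrands may vary with
  \<open>n\<close>, because the lower bound uses it with a different scale for each index;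
  \<open>le\<close> is therefore a joint condition on the functions and their arguments.\<close>

lemma weak_conv_m_Fatou:
  fixes M :: "'a measure" and Mn :: "nat \<Rightarrow> 'b measure" and X :: "'a \<Rightarrow> real"
    and Xn :: "nat \<Rightarrow> 'b \<Rightarrow> real" and f :: "real \<Rightarrow> ennreal" and fn :: "nat \<Rightarrow> real \<Rightarrow> ennreal"
  assumes "prob_space M" "\<And>n. prob_space (Mn n)"
    and "X \<in> borel_measurable M" "\<And>n. Xn n \<in> borel_measurable (Mn n)"
    and "weak_conv_m (\<lambda>n. distr (Mn n) borel (Xn n)) (distr M borel X)"
    and f [measurable]: "f \<in> borel_measurable borel" "\<And>n. fn n \<in> borel_measurable borel"
    and le: "\<And>yn y. yn \<longlonglongrightarrow> y \<Longrightarrow> f y \<le> liminf (\<lambda>n. fn n (yn n))"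
  shows "(\<integral>\<^sup>+\<omega>. f (X \<omega>) \<partial>M) \<le> liminf (\<lambda>n. \<integral>\<^sup>+\<omega>. fn n (Xn n \<omega>) \<partial>Mn n)"
proof -
  from assms(1-5) obtain \<Omega> :: "real measure" and Yn Y where
    \<Omega>: "prob_space \<Omega>" and Y [measurable]: "\<And>n. Yn n \<in> borel_measurable \<Omega>" "Y \<in> borel_measurable \<Omega>"
    and eq: "\<And>n f. f \<in> borel_measurable borel \<Longrightarrow> (\<integral>\<^sup>+\<omega>. f (Xn n \<omega>) \<partial>Mn n) = (\<integral>\<^sup>+\<omega>. f (Yn n \<omega>) \<partial>\<Omega>)"
    "\<And>f. f \<in> borel_measurable borel \<Longrightarrow> (\<integral>\<^sup>+\<omega>. f (X \<omega>) \<partial>M) = (\<integral>\<^sup>+\<omega>. f (Y \<omega>) \<partial>\<Omega>)"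
    and lim: "\<And>\<omega>. \<omega> \<in> space \<Omega> \<Longrightarrow> (\<lambda>n. Yn n \<omega>) \<longlonglongrightarrow> Y \<omega>"
    by (rule weak_conv_m_representation) blast
  have "(\<integral>\<^sup>+\<omega>. f (Y \<omega>) \<partial>\<Omega>) \<le> (\<integral>\<^sup>+\<omega>. liminf (\<lambda>n. fn n (Yn n \<omega>)) \<partial>\<Omega>)"
    by (intro nn_integral_mono le lim)
  also have "\<dots> \<le> liminf (\<lambda>n. \<integral>\<^sup>+\<omega>. fn n (Yn n \<omega>) \<partial>\<Omega>)"
    by (rule nn_integral_liminf) simp
  finally show ?thesis
    by (simp add: eq f)
qed

text \<open>Truncation at level \<open>N\<close>: the part \<open>f (min y N)\<close> is controlled
  by dominated convergence, and the error lives on \<open>y > N\<close>, where \<open>tail\<close>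
  bounds it uniformly in \<open>n\<close>.\<close>

lemma weak_conv_m_limsup:
  fixes M :: "'a measure" and Mn :: "nat \<Rightarrow> 'b measure" and X :: "'a \<Rightarrow> real"
    and Xn :: "nat \<Rightarrow> 'b \<Rightarrow> real" and f :: "real \<Rightarrow> real"
  assumes "prob_space M" "\<And>n. prob_space (Mn n)"
    and "X \<in> borel_measurable M" "\<And>n. Xn n \<in> borel_measurable (Mn n)"
    and "weak_conv_m (\<lambda>n. distr (Mn n) borel (Xn n)) (distr M borel X)"
    and mono: "mono f" and cont: "continuous_on UNIV f"
    and tail: "((\<lambda>N. SUP n. \<integral>\<^sup>+\<omega>. ennreal (f (Xn n \<omega>) * indicator {N<..} (Xn n \<omega>)) \<partial>Mn n) \<longlongrightarrow> 0) at_top"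
  shows "limsup (\<lambda>n. \<integral>\<^sup>+\<omega>. ennreal (f (Xn n \<omega>)) \<partial>Mn n) \<le> (\<integral>\<^sup>+\<omega>. ennreal (f (X \<omega>)) \<partial>M)"
proof -
  have f [measurable]: "f \<in> borel_measurable borel"
    using cont by (rule borel_measurable_continuous_onI)
  from assms(1-5) obtain \<Omega> :: "real measure" and Yn Y where
    \<Omega>: "prob_space \<Omega>" and Y [measurable]: "\<And>n. Yn n \<in> borel_measurable \<Omega>" "Y \<in> borel_measurable \<Omega>"
    and eq: "\<And>n f. f \<in> borel_measurable borel \<Longrightarrow> (\<integral>\<^sup>+\<omega>. f (Xn n \<omega>) \<partial>Mn n) = (\<integral>\<^sup>+\<omega>. f (Yn n \<omega>) \<partial>\<Omega>)"
    "\<And>f. f \<in> borel_measurable borel \<Longrightarrow> (\<integral>\<^sup>+\<omega>. f (X \<omega>) \<partial>M) = (\<integral>\<^sup>+\<omega>. f (Y \<omega>) \<partial>\<Omega>)"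
    and lim: "\<And>\<omega>. \<omega> \<in> space \<Omega> \<Longrightarrow> (\<lambda>n. Yn n \<omega>) \<longlonglongrightarrow> Y \<omega>"
    by (rule weak_conv_m_representation) blast
  interpret prob_space \<Omega> by fact
  define T where "T N = (SUP n. \<integral>\<^sup>+\<omega>. ennreal (f (Yn n \<omega>) * indicator {N<..} (Yn n \<omega>)) \<partial>\<Omega>)" for N
  have T0: "(T \<longlongrightarrow> 0) at_top"
    using tail unfolding T_def
    by (subst (asm) eq(1)[of "\<lambda>y. ennreal (f y * indicator {_<..} y)"]) (simp_all)
  have "limsup (\<lambda>n. \<integral>\<^sup>+\<omega>. ennreal (f (Yn n \<omega>)) \<partial>\<Omega>) \<le> (\<integral>\<^sup>+\<omega>. ennreal (f (Y \<omega>)) \<partial>\<Omega>) + T N" for N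
  proof -
    \<comment> \<open>Monotonicity bounds the truncated integrand by the constant
      \<open>f N\<close>, which is integrable over a probability space.\<close>
    have "(\<lambda>n. \<integral>\<^sup>+\<omega>. ennreal (f (min (Yn n \<omega>) N)) \<partial>\<Omega>) \<longlonglongrightarrow> (\<integral>\<^sup>+\<omega>. ennreal (f (min (Y \<omega>) N)) \<partial>\<Omega>)"
    proof (rule nn_integral_dominated_convergence[where w="\<lambda>_. ennreal (f N)"])
      show "AE \<omega> in \<Omega>. (\<lambda>n. ennreal (f (min (Yn n \<omega>) N))) \<longlonglongrightarrow> ennreal (f (min (Y \<omega>) N))"
        by (intro AE_I2 tendsto_ennrealI continuous_on_tendsto_compose[OF cont] tendsto_min lim) auto
      show "AE \<omega> in \<Omega>. ennreal (f (min (Yn n \<omega>) N)) \<le> ennreal (f N)" for n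
        by (intro AE_I2 ennreal_leI monoD[OF mono]) simp
    qed (simp_all add: emeasure_space_1)
    then have l: "(\<lambda>n. (\<integral>\<^sup>+\<omega>. ennreal (f (min (Yn n \<omega>) N)) \<partial>\<Omega>) + T N)
        \<longlonglongrightarrow> (\<integral>\<^sup>+\<omega>. ennreal (f (min (Y \<omega>) N)) \<partial>\<Omega>) + T N"
      by (intro tendsto_add) auto
    have "(\<integral>\<^sup>+\<omega>. ennreal (f (Yn n \<omega>)) \<partial>\<Omega>) \<le> (\<integral>\<^sup>+\<omega>. ennreal (f (min (Yn n \<omega>) N)) \<partial>\<Omega>) + T N" for n
    proof -
      have "(\<integral>\<^sup>+\<omega>. ennreal (f (Yn n \<omega>)) \<partial>\<Omega>) \<le>
          (\<integral>\<^sup>+\<omega>. ennreal (f (min (Yn n \<omega>) N)) + ennreal (f (Yn n \<omega>) * indicator {N<..} (Yn n \<omega>)) \<partial>\<Omega>)"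
        by (intro nn_integral_mono) (auto simp: min_def indicator_def)
      also have "\<dots> = (\<integral>\<^sup>+\<omega>. ennreal (f (min (Yn n \<omega>) N)) \<partial>\<Omega>) +
          (\<integral>\<^sup>+\<omega>. ennreal (f (Yn n \<omega>) * indicator {N<..} (Yn n \<omega>)) \<partial>\<Omega>)"
        by (rule nn_integral_add) auto
      also have "\<dots> \<le> (\<integral>\<^sup>+\<omega>. ennreal (f (min (Yn n \<omega>) N)) \<partial>\<Omega>) + T N"
        unfolding T_def by (intro add_left_mono SUP_upper) simp
      finally show ?thesis .
    qed
    then have "limsup (\<lambda>n. \<integral>\<^sup>+\<omega>. ennreal (f (Yn n \<omega>)) \<partial>\<Omega>) \<le>
        limsup (\<lambda>n. (\<integral>\<^sup>+\<omega>. ennreal (f (min (Yn n \<omega>) N)) \<partial>\<Omega>) + T N)"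
      by (intro Limsup_mono always_eventually) simp
    also have "\<dots> = (\<integral>\<^sup>+\<omega>. ennreal (f (min (Y \<omega>) N)) \<partial>\<Omega>) + T N"
      by (rule lim_imp_Limsup[OF _ l]) simp
    also have "\<dots> \<le> (\<integral>\<^sup>+\<omega>. ennreal (f (Y \<omega>)) \<partial>\<Omega>) + T N"
      by (intro add_right_mono nn_integral_mono ennreal_leI monoD[OF mono]) simp
    finally show ?thesis .
  qed
  \<comment> \<open>The bound holds for every \<open>N\<close> and its left side does not involve
    \<open>N\<close>, so the tail term disappears in the limit.\<close>
  moreover have "((\<lambda>N. (\<integral>\<^sup>+\<omega>. ennreal (f (Y \<omega>)) \<partial>\<Omega>) + T N) \<longlongrightarrow> (\<integral>\<^sup>+\<omega>. ennreal (f (Y \<omega>)) \<partial>\<Omega>) + 0) at_top"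
    by (intro tendsto_add T0) simp
  ultimately have "limsup (\<lambda>n. \<integral>\<^sup>+\<omega>. ennreal (f (Yn n \<omega>)) \<partial>\<Omega>) \<le> (\<integral>\<^sup>+\<omega>. ennreal (f (Y \<omega>)) \<partial>\<Omega>)"
    by (intro tendsto_lowerbound[of _ _ at_top]) (auto intro: always_eventually)
  then show ?thesis
    by (simp add: eq(1)[of "\<lambda>y. ennreal (f y)"] eq(2)[of "\<lambda>y. ennreal (f y)"])
qed

section \<open>The functions \<open>h_\<alpha>\<close>\<close>

lemma pos_ereal_cases:
  assumes "(0::ereal) < \<alpha>"
  obtains (infinite) "\<alpha> = \<infinity>" | (finite) a where "\<alpha> = ereal a" "0 < a"
  using assms by (cases \<alpha>) auto

lemma h_fun_nonneg: "0 \<le> h_fun \<alpha> u"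
  by (simp add: h_fun_def)

lemma h_fun_0: "0 < \<alpha> \<Longrightarrow> h_fun \<alpha> 0 = 1"
  by (simp add: h_fun_def)

lemma mono_h_fun: "0 < \<alpha> \<Longrightarrow> mono (h_fun \<alpha>)"
  by (erule pos_ereal_cases)
    (auto simp: h_fun_def mono_def divide_right_mono intro!: powr_mono2 max.mono)

lemma continuous_on_h_fun: "0 < \<alpha> \<Longrightarrow> continuous_on A (h_fun \<alpha>)"
  by (erule pos_ereal_cases)
    (auto simp: h_fun_def[abs_def] intro!: continuous_intros continuous_on_powr')

lemma borel_measurable_h_fun [measurable]: "0 < \<alpha> \<Longrightarrow> h_fun \<alpha> \<in> borel_measurable borel"
  by (intro borel_measurable_mono mono_h_fun)

lemma tendsto_h_fun:
  "0 < \<alpha> \<Longrightarrow> (f \<longlongrightarrow> u) F \<Longrightarrow> ((\<lambda>x. h_fun \<alpha> (f x)) \<longlongrightarrow> h_fun \<alpha> u) F"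
  by (rule continuous_on_tendsto_compose[OF continuous_on_h_fun[of \<alpha> UNIV]]) auto

lemma filterlim_h_fun_at_top:
  assumes "0 < \<alpha>" shows "filterlim (h_fun \<alpha>) at_top at_top"
  using assms
proof (cases rule: pos_ereal_cases)
  case infinite
  then show ?thesis by (simp add: h_fun_def[abs_def] exp_at_top)
next
  case (finite a)
  then have "filterlim (\<lambda>u. (1 + u / a) powr a) at_top at_top"
    by real_asymp
  moreover have "\<forall>\<^sub>F u in at_top. (1 + u / a) powr a \<le> h_fun \<alpha> u"
    using eventually_ge_at_top[of 0]
    by eventually_elim (use finite in \<open>auto simp: h_fun_def\<close>)
  ultimately show ?thesis
    by (rule filterlim_at_top_mono)
qed

lemma h_fun_at_bot:
  assumes "0 < \<alpha>" shows "(h_fun \<alpha> \<longlongrightarrow> 0) at_bot"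
  using assms
proof (cases rule: pos_ereal_cases)
  case infinite
  then show ?thesis by (simp add: h_fun_def[abs_def] exp_at_bot)
next
  case (finite a)
  have "\<forall>\<^sub>F u in at_bot. h_fun \<alpha> u = 0"
    using eventually_le_at_bot[of "- a"]
    by eventually_elim (use finite in \<open>auto simp: h_fun_def field_simps max_def\<close>)
  then show ?thesis
    by (rule tendsto_eventually)
qed

text \<open>The weight whose integrability defines \<open>X_class\<close> and \<open>unif_int_cond\<close>; the parameter \<open>l\<close>
  only matters for \<open>\<alpha> = \<infinity>\<close>.\<close>

definition growth_weight :: "ereal \<Rightarrow> real \<Rightarrow> real \<Rightarrow> real" where
  "growth_weight \<alpha> l y = (if \<alpha> = \<infinity> then exp (l * y) else max 0 y powr real_of_ereal \<alpha>)"

lemma growth_weight_nonneg: "0 \<le> growth_weight \<alpha> l y"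
  by (simp add: growth_weight_def)

lemma borel_measurable_growth_weight [measurable]: "growth_weight \<alpha> l \<in> borel_measurable borel"
  unfolding growth_weight_def[abs_def] by measurable

section \<open>Domination of \<open>h_fun\<close> by the weight\<close>

text \<open>Allows the additive constant in \<open>1 + growth_weight\<close> to be absorbed into the
  weight on tails beyond 1.\<close>

lemma growth_weight_ge_1: "0 < \<alpha> \<Longrightarrow> 0 < l \<Longrightarrow> 1 < y \<Longrightarrow> 1 \<le> growth_weight \<alpha> l y"
  by (erule pos_ereal_cases) (auto simp: growth_weight_def ge_one_powr_ge_zero)

text \<open>For infinite \<alpha> the factor \<open>exp (- l * x)\<close> splits off. For finite
  \<alpha> the base of the power grows at most linearly in \<open>max 1 y\<close>; the summand 1
  covers \<open>y \<le> 0\<close>, where the weight vanishes but \<open>h_fun\<close> may not. The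
  constant depends on \<open>x\<close> and \<open>l\<close>, not on \<open>y\<close>.\<close>

lemma h_fun_le_growth_weight:
  assumes "0 < \<alpha>" "0 < l"
  obtains K where "0 \<le> K" "\<And>y. h_fun \<alpha> (l * (y - x)) \<le> K * (1 + growth_weight \<alpha> l y)"
  using assms(1)
proof (cases rule: pos_ereal_cases)
  case infinite
  show ?thesis
  proof (rule that)
    show "h_fun \<alpha> (l * (y - x)) \<le> exp (- l * x) * (1 + growth_weight \<alpha> l y)" for y
      using infinite by (simp add: h_fun_def growth_weight_def algebra_simps exp_diff exp_minus divide_simps)
  qed simp
next
  case (finite a)
  \<comment> \<open>Chosen so that \<open>1 + l * (y - x) / a \<le> C * max 1 y\<close>: it adds up
    \<open>1 \<le> max 1 y\<close> and
    \<open>y - x \<le> (1 + \<bar>x\<bar>) * max 1 y\<close>.\<close>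
  define C where "C = 1 + l * (1 + \<bar>x\<bar>) / a"
  have C: "0 < C"
    using finite assms by (simp add: C_def add_pos_nonneg)
  have max1: "max 1 y powr a \<le> 1 + max 0 y powr a" for y :: real
    by (cases "y \<le> 1") (auto simp: max_def)
  show ?thesis
  proof (rule that)
    show "0 \<le> C powr a" by simp
    fix y
    have "y - x \<le> (1 + \<bar>x\<bar>) * max 1 y"
    proof -
      have "\<bar>x\<bar> * 1 \<le> \<bar>x\<bar> * max 1 y" by (intro mult_left_mono) auto
      then show ?thesis by (simp add: distrib_right)
    qed
    then have "l * (y - x) / a \<le> l * ((1 + \<bar>x\<bar>) * max 1 y) / a"
      using assms finite by (intro divide_right_mono mult_left_mono) auto
    then have "1 + l * (y - x) / a \<le> max 1 y + l * (1 + \<bar>x\<bar>) / a * max 1 y"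
      by (simp add: mult.assoc)
    then have "1 + l * (y - x) / a \<le> C * max 1 y"
      by (simp add: C_def distrib_right)
    then have "max 0 (1 + l * (y - x) / a) \<le> C * max 1 y"
      using C by (intro max.boundedI) auto
    then have "max 0 (1 + l * (y - x) / a) powr a \<le> (C * max 1 y) powr a"
      using finite by (intro powr_mono2) auto
    also have "\<dots> = C powr a * max 1 y powr a"
      using C by (simp add: powr_mult)
    also have "\<dots> \<le> C powr a * (1 + max 0 y powr a)"
      by (intro mult_left_mono max1) simp
    finally show "h_fun \<alpha> (l * (y - x)) \<le> C powr a * (1 + growth_weight \<alpha> l y)"
      using finite by (simp add: h_fun_def growth_weight_def)
  qed
qed

text \<open>Gives both cases of the class one form: for infinite \<alpha> the scale comes from
  \<open>Lambda_set\<close>, for finite \<alpha> the value 1 is an arbitrary choice.\<close>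

lemma X_class_growth_weight:
  assumes "0 < \<alpha>" "X \<in> X_class \<alpha> M"
  obtains l where "0 < l" "(\<integral>\<^sup>+\<omega>. ennreal (growth_weight \<alpha> l (X \<omega>)) \<partial>M) < \<infinity>"
proof (cases "\<alpha> = \<infinity>")
  case True
  with assms(2) obtain l where "l \<in> Lambda_set M X"
    by (auto simp: X_class_def)
  with True show ?thesis
    by (intro that[of l]) (auto simp: Lambda_set_def growth_weight_def)
next
  case False
  with assms(2) show ?thesis
    by (intro that[of 1]) (auto simp: X_class_def growth_weight_def)
qed

text \<open>For infinite \<alpha> the two assumptions on \<open>l\<close> say exactly that
  \<open>l\<close> lies in \<open>Lambda_set M X\<close>.\<close>

lemma unif_int_cond_growth_weight:
  assumes "unif_int_cond \<alpha> M X Mn Xn" "0 < l"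
    and "(\<integral>\<^sup>+\<omega>. ennreal (growth_weight \<alpha> l (X \<omega>)) \<partial>M) < \<infinity>"
  shows "((\<lambda>N. SUP n. \<integral>\<^sup>+\<omega>. ennreal (growth_weight \<alpha> l (Xn n \<omega>) * indicator {N<..} (Xn n \<omega>)) \<partial>Mn n)
    \<longlongrightarrow> 0) at_top"
  using assms by (auto simp: unif_int_cond_def growth_weight_def Lambda_set_def split: if_splits)

text \<open>Shows that uniform integrability is available at every scale with finite expectation.
  For infinite \<alpha> the weight is a constant multiple of the integrand; for finite \<alpha> its
  integrability is the class condition.\<close>

lemma growth_weight_finite:
  assumes "0 < \<alpha>" "X \<in> X_class \<alpha> M"
    and fin: "(\<integral>\<^sup>+\<omega>. ennreal (h_fun \<alpha> (l * (X \<omega> - x))) \<partial>M) < \<infinity>"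
  shows "(\<integral>\<^sup>+\<omega>. ennreal (growth_weight \<alpha> l (X \<omega>)) \<partial>M) < \<infinity>"
proof (cases "\<alpha> = \<infinity>")
  case True
  have [measurable]: "X \<in> borel_measurable M"
    using assms by (simp add: X_class_def)
  have "(\<integral>\<^sup>+\<omega>. ennreal (growth_weight \<alpha> l (X \<omega>)) \<partial>M) =
      (\<integral>\<^sup>+\<omega>. ennreal (exp (l * x)) * ennreal (h_fun \<alpha> (l * (X \<omega> - x))) \<partial>M)"
    using True by (simp add: growth_weight_def h_fun_def algebra_simps flip: ennreal_mult' exp_add)
  also have "\<dots> = ennreal (exp (l * x)) * (\<integral>\<^sup>+\<omega>. ennreal (h_fun \<alpha> (l * (X \<omega> - x))) \<partial>M)"
    using assms(1) by (intro nn_integral_cmult) measurable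
  also have "\<dots> < \<infinity>"
    using fin by (simp add: ennreal_mult_less_top)
  finally show ?thesis .
next
  case False
  with assms(2) show ?thesis
    by (auto simp: X_class_def growth_weight_def)
qed

section \<open>The functional \<open>P_\<alpha>\<close>\<close>

lemma P_fun_le: "0 < l \<Longrightarrow> P_fun \<alpha> M X x \<le> (\<integral>\<^sup>+\<omega>. ennreal (h_fun \<alpha> (l * (X \<omega> - x))) \<partial>M)"
  unfolding P_fun_def by (rule INF_lower) simp

text \<open>At every scale the integrand is nonnegative and equals
  \<open>h_fun \<alpha> 0 = 1\<close> on the event \<open>X = x\<close>.\<close>

lemma P_fun_ge_prob:
  assumes "0 < \<alpha>" "prob_space M" "X \<in> borel_measurable M"
  shows "ennreal (measure M {\<omega> \<in> space M. X \<omega> = x}) \<le> P_fun \<alpha> M X x"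
  unfolding P_fun_def
proof (rule INF_greatest)
  fix l :: real
  interpret prob_space M by fact
  note [measurable] = assms(3)
  have "ennreal (measure M {\<omega> \<in> space M. X \<omega> = x}) = (\<integral>\<^sup>+\<omega>. indicator {\<omega> \<in> space M. X \<omega> = x} \<omega> \<partial>M)"
    by (simp add: emeasure_eq_measure)
  also have "\<dots> \<le> (\<integral>\<^sup>+\<omega>. ennreal (h_fun \<alpha> (l * (X \<omega> - x))) \<partial>M)"
    using assms(1) by (intro nn_integral_mono) (auto simp: indicator_def h_fun_0)
  finally show "ennreal (measure M {\<omega> \<in> space M. X \<omega> = x}) \<le> (\<integral>\<^sup>+\<omega>. ennreal (h_fun \<alpha> (l * (X \<omega> - x))) \<partial>M)" .
qed

text \<open>Let the scale tend to infinity: the integrand then tends to the indicator of \<open>X = x\<close>.\<close>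

lemma P_fun_le_prob:
  assumes "0 < \<alpha>" "prob_space M" and X [measurable]: "X \<in> borel_measurable M"
    and le: "AE \<omega> in M. X \<omega> \<le> x"
  shows "P_fun \<alpha> M X x \<le> ennreal (measure M {\<omega> \<in> space M. X \<omega> = x})"
proof -
  interpret prob_space M by fact
  note [measurable] = borel_measurable_h_fun[OF assms(1)]
  \<comment> \<open>The scales are \<open>Suc k\<close> so that each is positive and hence
    admissible in the infimum. Since \<open>X \<le> x\<close> almost surely, the constant 1
    dominates.\<close>
  have "(\<lambda>k. \<integral>\<^sup>+\<omega>. ennreal (h_fun \<alpha> (real (Suc k) * (X \<omega> - x))) \<partial>M)
      \<longlonglongrightarrow> (\<integral>\<^sup>+\<omega>. indicator {\<omega> \<in> space M. X \<omega> = x} \<omega> \<partial>M)"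
  proof (rule nn_integral_dominated_convergence[where w="\<lambda>_. 1"])
    show "AE \<omega> in M. ennreal (h_fun \<alpha> (real (Suc k) * (X \<omega> - x))) \<le> 1" for k
      using le
    proof eventually_elim
      case (elim \<omega>)
      then have "h_fun \<alpha> (real (Suc k) * (X \<omega> - x)) \<le> h_fun \<alpha> 0"
        by (intro monoD[OF mono_h_fun[OF assms(1)]]) (simp add: mult_nonneg_nonpos)
      then show ?case by (simp add: h_fun_0[OF assms(1)])
    qed
    show "AE \<omega> in M. (\<lambda>k. ennreal (h_fun \<alpha> (real (Suc k) * (X \<omega> - x))))
        \<longlonglongrightarrow> indicator {\<omega> \<in> space M. X \<omega> = x} \<omega>"
      using le AE_space
    proof eventually_elim
      case (elim \<omega>)
      show ?case
      proof (cases "X \<omega> = x")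
        case True
        with elim show ?thesis by (simp add: h_fun_0[OF assms(1)])
      next
        case False
        then have "X \<omega> - x < 0" using elim by simp
        then have "filterlim (\<lambda>k. real (Suc k) * (X \<omega> - x)) at_bot sequentially"
          by real_asymp
        from filterlim_compose[OF h_fun_at_bot[OF assms(1)] this]
        have "(\<lambda>k. ennreal (h_fun \<alpha> (real (Suc k) * (X \<omega> - x)))) \<longlonglongrightarrow> ennreal 0"
          by (rule tendsto_ennrealI)
        with False show ?thesis by simp
      qed
    qed
  qed (simp_all add: emeasure_space_1)
  also have "(\<integral>\<^sup>+\<omega>. indicator {\<omega> \<in> space M. X \<omega> = x} \<omega> \<partial>M) = ennreal (measure M {\<omega> \<in> space M. X \<omega> = x})"
    by (simp add: emeasure_eq_measure)
  finally show ?thesis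
    by (rule tendsto_lowerbound) (simp_all add: P_fun_le)
qed

text \<open>Let the scale tend to zero.\<close>

lemma P_fun_le_1:
  assumes "0 < \<alpha>" "prob_space M" "X \<in> X_class \<alpha> M"
  shows "P_fun \<alpha> M X x \<le> 1"
proof -
  interpret prob_space M by fact
  have [measurable]: "X \<in> borel_measurable M" using assms by (simp add: X_class_def)
  note [measurable] = borel_measurable_h_fun[OF assms(1)]
  obtain l where l: "0 < l" "(\<integral>\<^sup>+\<omega>. ennreal (growth_weight \<alpha> l (X \<omega>)) \<partial>M) < \<infinity>"
    using X_class_growth_weight assms(1,3) .
  obtain K where K: "0 \<le> K" "\<And>y. h_fun \<alpha> (l * (y - x)) \<le> K * (1 + growth_weight \<alpha> l y)"
    by (rule h_fun_le_growth_weight[OF assms(1) l(1), of x]) blast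
  \<comment> \<open>Dominates all scales \<open>l / real (Suc k) \<le> l\<close> at once: the
    integrand is at most 1 where \<open>X \<le> x\<close>, and at most its value at scale
    \<open>l\<close> where \<open>X > x\<close>.\<close>
  let ?w = "\<lambda>\<omega>. 1 + ennreal K * (1 + ennreal (growth_weight \<alpha> l (X \<omega>)))"
  have "(\<lambda>k. \<integral>\<^sup>+\<omega>. ennreal (h_fun \<alpha> (l / real (Suc k) * (X \<omega> - x))) \<partial>M) \<longlonglongrightarrow> (\<integral>\<^sup>+\<omega>. 1 \<partial>M)"
  proof (rule nn_integral_dominated_convergence[where w="?w"])
    have "(\<integral>\<^sup>+\<omega>. ?w \<omega> \<partial>M) = 1 + ennreal K * (1 + (\<integral>\<^sup>+\<omega>. ennreal (growth_weight \<alpha> l (X \<omega>)) \<partial>M))"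
      by (simp add: nn_integral_add nn_integral_cmult emeasure_space_1)
    also have "\<dots> < \<infinity>"
      using l(2) by (simp add: ennreal_mult_less_top)
    finally show "(\<integral>\<^sup>+\<omega>. ?w \<omega> \<partial>M) < \<infinity>" .
    show "AE \<omega> in M. ennreal (h_fun \<alpha> (l / real (Suc k) * (X \<omega> - x))) \<le> ?w \<omega>" for k
    proof (intro AE_I2)
      fix \<omega>
      \<comment> \<open>The maximum with 0 is needed because shrinking the scale raises the argument
        when \<open>X \<omega> < x\<close>.\<close>
      have "h_fun \<alpha> (l / real (Suc k) * (X \<omega> - x)) \<le> h_fun \<alpha> (max 0 (l * (X \<omega> - x)))"
      proof (rule monoD[OF mono_h_fun[OF assms(1)]])
        show "l / real (Suc k) * (X \<omega> - x) \<le> max 0 (l * (X \<omega> - x))"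
        proof (cases "X \<omega> \<le> x")
          case True
          then show ?thesis using l(1)
            by (intro max.coboundedI1 mult_nonneg_nonpos) auto
        next
          case False
          then show ?thesis using l(1)
            by (intro max.coboundedI2 mult_right_mono) (auto simp: field_simps)
        qed
      qed
      also have "\<dots> \<le> 1 + h_fun \<alpha> (l * (X \<omega> - x))"
        by (simp add: max_def h_fun_0[OF assms(1)] h_fun_nonneg)
      also have "\<dots> \<le> 1 + K * (1 + growth_weight \<alpha> l (X \<omega>))"
        using K(2) by simp
      finally have "ennreal (h_fun \<alpha> (l / real (Suc k) * (X \<omega> - x))) \<le> ennreal (1 + K * (1 + growth_weight \<alpha> l (X \<omega>)))"
        by (rule ennreal_leI)
      also have "\<dots> = ?w \<omega>"
        using K(1) by (simp add: ennreal_plus ennreal_mult growth_weight_nonneg del: ennreal_plus[symmetric])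
      finally show "ennreal (h_fun \<alpha> (l / real (Suc k) * (X \<omega> - x))) \<le> ?w \<omega>" .
    qed
    show "AE \<omega> in M. (\<lambda>k. ennreal (h_fun \<alpha> (l / real (Suc k) * (X \<omega> - x)))) \<longlonglongrightarrow> 1"
    proof (intro AE_I2)
      fix \<omega>
      have "(\<lambda>k. l / real (Suc k) * (X \<omega> - x)) \<longlonglongrightarrow> 0"
        by real_asymp
      then have "(\<lambda>k. ennreal (h_fun \<alpha> (l / real (Suc k) * (X \<omega> - x)))) \<longlonglongrightarrow> ennreal (h_fun \<alpha> 0)"
        by (intro tendsto_ennrealI tendsto_h_fun assms(1))
      then show "(\<lambda>k. ennreal (h_fun \<alpha> (l / real (Suc k) * (X \<omega> - x)))) \<longlonglongrightarrow> 1"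
        by (simp add: h_fun_0[OF assms(1)])
    qed
  qed simp_all
  then have "P_fun \<alpha> M X x \<le> (\<integral>\<^sup>+\<omega>. 1 \<partial>M)"
    by (rule tendsto_lowerbound) (intro always_eventually allI P_fun_le divide_pos_pos l(1), simp_all)
  then show ?thesis
    by (simp add: emeasure_space_1)
qed

section \<open>The right end of the support\<close>

text \<open>Some support point lies above \<open>x\<close>, and the open ray \<open>{x<..}\<close>
  is a neighbourhood of it.\<close>

lemma prob_greater_pos:
  assumes "prob_space M" "X \<in> borel_measurable M" "ereal x < x_star M X"
  shows "0 < measure M {\<omega> \<in> space M. x < X \<omega>}"
proof -
  note [measurable] = assms(2)
  obtain t where "t \<in> rv_support M X" "x < t"
    using assms(3) by (auto simp: x_star_def less_Sup_iff)
  then have "0 < measure (distr M borel X) {x<..}"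
    by (auto simp: rv_support_def)
  then show ?thesis
    by (simp add: measure_distr vimage_def Int_def conj_commute)
qed

text \<open>The complement of the support is the union of all open null sets. By the Lindelof
  property countably many of them already cover it, so it is null, and it contains
  \<open>{b<..}\<close>.\<close>

lemma AE_le_x_star:
  assumes "prob_space M" "X \<in> borel_measurable M" "x_star M X \<le> ereal b"
  shows "AE \<omega> in M. X \<omega> \<le> b"
proof -
  interpret prob_space M by fact
  note [measurable] = assms(2)
  interpret D: prob_space "distr M borel X" by (rule prob_space_distr) simp
  define \<U> where "\<U> = {U. open U \<and> measure (distr M borel X) U = 0}"
  obtain \<V> where \<V>: "\<V> \<subseteq> \<U>" "countable \<V>" "\<Union>\<V> = \<Union>\<U>"
    using Lindelof[of \<U>] by (auto simp: \<U>_def)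
  have "\<Union>\<V> \<in> null_sets (distr M borel X)"
  proof -
    have "U \<in> null_sets (distr M borel X)" if "U \<in> \<V>" for U
      using that \<V>(1) by (auto simp: \<U>_def null_sets_def D.emeasure_eq_measure)
    from null_sets_UN'[OF \<V>(2), of "\<lambda>U. U", OF this] show ?thesis by simp
  qed
  moreover have "{b<..} \<subseteq> \<Union>\<V>"
  proof
    fix t assume "t \<in> {b<..}"
    then have "t \<notin> rv_support M X"
      using assms(3) unfolding x_star_def Sup_le_iff by fastforce
    then show "t \<in> \<Union>\<V>"
      unfolding \<V>(3) by (auto simp: \<U>_def rv_support_def less_le)
  qed
  ultimately have "AE y in distr M borel X. y \<le> b"
    by (intro AE_I'[of "\<Union>\<V>"]) auto
  then show ?thesis
    by (subst (asm) AE_distr_iff) auto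
qed

section \<open>Convergence\<close>

text \<open>It suffices to bound the limit superior by the expectation at each fixed scale. Where
  that expectation is infinite the bound is trivial; otherwise the tail condition on the weight
  passes to \<open>h_fun\<close> and truncation applies.\<close>

lemma limsup_P_fun_le:
  fixes \<alpha> :: ereal
    and M :: "'a measure" and X :: "'a \<Rightarrow> real"
    and Mn :: "nat \<Rightarrow> 'b measure" and Xn :: "nat \<Rightarrow> 'b \<Rightarrow> real"
  assumes \<alpha>: "0 < \<alpha>"
    and M: "prob_space M" "X \<in> X_class \<alpha> M" "\<And>n. prob_space (Mn n)"
    and Xn: "\<And>n. Xn n \<in> borel_measurable (Mn n)"
    and conv: "weak_conv_m (\<lambda>n. distr (Mn n) borel (Xn n)) (distr M borel X)"
    and ui: "unif_int_cond \<alpha> M X Mn Xn"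
  shows "limsup (\<lambda>n. P_fun \<alpha> (Mn n) (Xn n) x) \<le> P_fun \<alpha> M X x"
  unfolding P_fun_def[of \<alpha> M]
proof (rule INF_greatest)
  fix l :: real assume "l \<in> {0<..}"
  then have l: "0 < l" by simp
  have X: "X \<in> borel_measurable M" using M(2) by (simp add: X_class_def)
  note [measurable] = Xn
  show "limsup (\<lambda>n. P_fun \<alpha> (Mn n) (Xn n) x) \<le> (\<integral>\<^sup>+\<omega>. ennreal (h_fun \<alpha> (l * (X \<omega> - x))) \<partial>M)"
  proof (cases "(\<integral>\<^sup>+\<omega>. ennreal (h_fun \<alpha> (l * (X \<omega> - x))) \<partial>M) < \<infinity>")
    case False
    then show ?thesis by (simp add: less_top[symmetric])
  next
    case True
    define G where "G N = (SUP n. \<integral>\<^sup>+\<omega>. ennreal (growth_weight \<alpha> l (Xn n \<omega>) * indicator {N<..} (Xn n \<omega>)) \<partial>Mn n)"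
      for N
    define H where "H N = (SUP n. \<integral>\<^sup>+\<omega>. ennreal (h_fun \<alpha> (l * (Xn n \<omega> - x)) * indicator {N<..} (Xn n \<omega>)) \<partial>Mn n)"
      for N
    obtain K where K: "0 \<le> K" "\<And>y. h_fun \<alpha> (l * (y - x)) \<le> K * (1 + growth_weight \<alpha> l y)"
      by (rule h_fun_le_growth_weight[OF \<alpha> l, of x]) blast
    have G0: "(G \<longlongrightarrow> 0) at_top"
      unfolding G_def by (rule unif_int_cond_growth_weight[OF ui l growth_weight_finite[OF \<alpha> M(2) True]])
    \<comment> \<open>For \<open>N \<ge> 1\<close> the weight is at least 1 beyond \<open>N\<close>,
      so \<open>1 + growth_weight\<close> is at most twice the weight; hence the factor
      \<open>2 * K\<close>.\<close>
    have HG: "H N \<le> ennreal (2 * K) * G N" if "1 \<le> N" for N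
      unfolding H_def
    proof (rule SUP_least)
      fix n
      have "h_fun \<alpha> (l * (y - x)) * indicator {N<..} y \<le> 2 * K * (growth_weight \<alpha> l y * indicator {N<..} y)" for y
      proof (cases "N < y")
        case True
        have "K * (1 + growth_weight \<alpha> l y) \<le> K * (2 * growth_weight \<alpha> l y)"
          using growth_weight_ge_1[OF \<alpha> l, of y] True that K(1) by (intro mult_left_mono) auto
        with K(2)[of y] True show ?thesis by simp
      qed simp
      then have "(\<integral>\<^sup>+\<omega>. ennreal (h_fun \<alpha> (l * (Xn n \<omega> - x)) * indicator {N<..} (Xn n \<omega>)) \<partial>Mn n)
          \<le> (\<integral>\<^sup>+\<omega>. ennreal (2 * K) * ennreal (growth_weight \<alpha> l (Xn n \<omega>) * indicator {N<..} (Xn n \<omega>)) \<partial>Mn n)"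
        using K(1) by (intro nn_integral_mono) (simp add: growth_weight_nonneg ennreal_leI flip: ennreal_mult)
      also have "\<dots> = ennreal (2 * K) * (\<integral>\<^sup>+\<omega>. ennreal (growth_weight \<alpha> l (Xn n \<omega>) * indicator {N<..} (Xn n \<omega>)) \<partial>Mn n)"
        by (rule nn_integral_cmult) measurable
      also have "\<dots> \<le> ennreal (2 * K) * G N"
        unfolding G_def by (intro mult_left_mono SUP_upper) auto
      finally show "(\<integral>\<^sup>+\<omega>. ennreal (h_fun \<alpha> (l * (Xn n \<omega> - x)) * indicator {N<..} (Xn n \<omega>)) \<partial>Mn n)
          \<le> ennreal (2 * K) * G N" .
    qed
    have "((\<lambda>N. ennreal (2 * K) * G N) \<longlongrightarrow> ennreal (2 * K) * 0) at_top"
      by (intro ennreal_tendsto_cmult G0) simp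
    then have G': "((\<lambda>N. ennreal (2 * K) * G N) \<longlongrightarrow> 0) at_top"
      by simp
    have H0: "(H \<longlongrightarrow> 0) at_top"
    proof (rule tendsto_sandwich[OF _ _ tendsto_const G'])
      show "\<forall>\<^sub>F N in at_top. H N \<le> ennreal (2 * K) * G N"
        using eventually_ge_at_top[of 1] by eventually_elim (rule HG)
    qed simp
    have "limsup (\<lambda>n. P_fun \<alpha> (Mn n) (Xn n) x) \<le>
        limsup (\<lambda>n. \<integral>\<^sup>+\<omega>. ennreal (h_fun \<alpha> (l * (Xn n \<omega> - x))) \<partial>Mn n)"
      by (intro Limsup_mono always_eventually allI P_fun_le l)
    also have "\<dots> \<le> (\<integral>\<^sup>+\<omega>. ennreal (h_fun \<alpha> (l * (X \<omega> - x))) \<partial>M)"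
    proof (rule weak_conv_m_limsup[OF M(1,3) X Xn conv])
      show "mono (\<lambda>y. h_fun \<alpha> (l * (y - x)))"
        using l by (intro monoI monoD[OF mono_h_fun[OF \<alpha>]]) simp
      show "continuous_on UNIV (\<lambda>y. h_fun \<alpha> (l * (y - x)))"
        by (intro continuous_on_compose2[OF continuous_on_h_fun[OF \<alpha>, of UNIV]] continuous_intros) auto
    qed (rule H0[unfolded H_def])
    finally show ?thesis .
  qed
qed

section \<open>Limit inferior to the left of \<open>x_star\<close>\<close>

text \<open>Near-optimal scales along a bad subsequence accumulate at some \<open>L \<in> [0, \<infinity>]\<close>. Fatou's lemma
  excludes \<open>L = \<infinity>\<close>, since \<open>X > x\<close> has positive probability, and in the other cases gives the bound
  \<open>E h_\<alpha> (L (X - x)) \<ge> P_\<alpha> (X; x)\<close>, where for \<open>L = 0\<close> the left side is \<open>1\<close>.\<close>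

lemma liminf_P_fun_ge:
  fixes \<alpha> :: ereal
    and M :: "'a measure" and X :: "'a \<Rightarrow> real"
    and Mn :: "nat \<Rightarrow> 'b measure" and Xn :: "nat \<Rightarrow> 'b \<Rightarrow> real"
  assumes \<alpha>: "0 < \<alpha>"
    and M: "prob_space M" "X \<in> X_class \<alpha> M" "\<And>n. prob_space (Mn n)"
    and Xn: "\<And>n. Xn n \<in> borel_measurable (Mn n)"
    and conv: "weak_conv_m (\<lambda>n. distr (Mn n) borel (Xn n)) (distr M borel X)"
    and x: "ereal x < x_star M X"
  shows "P_fun \<alpha> M X x \<le> liminf (\<lambda>n. P_fun \<alpha> (Mn n) (Xn n) x)"
proof (rule ccontr)
  interpret prob_space M by fact
  have X [measurable]: "X \<in> borel_measurable M" using M(2) by (simp add: X_class_def)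
  note [measurable] = borel_measurable_h_fun[OF \<alpha>]
  assume "\<not> P_fun \<alpha> M X x \<le> liminf (\<lambda>n. P_fun \<alpha> (Mn n) (Xn n) x)"
  \<comment> \<open>The fixed level \<open>c\<close> keeps the gap strict: the limit arguments only
    give \<open>\<le> c\<close>, which still contradicts
    \<open>c < P_fun \<alpha> M X x\<close>.\<close>
  then obtain c where c: "liminf (\<lambda>n. P_fun \<alpha> (Mn n) (Xn n) x) < c" "c < P_fun \<alpha> M X x"
    using dense by (auto simp: not_le)
  have "\<exists>\<^sub>F n in sequentially. P_fun \<alpha> (Mn n) (Xn n) x < c"
  proof (rule ccontr)
    assume "\<not> ?thesis"
    then have "c \<le> liminf (\<lambda>n. P_fun \<alpha> (Mn n) (Xn n) x)"
      by (intro Liminf_bounded) (simp add: not_frequently not_less)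
    with c(1) show False by simp
  qed
  then have "infinite {n. P_fun \<alpha> (Mn n) (Xn n) x < c}"
    by (simp add: frequently_cofinite cofinite_eq_sequentially[symmetric])
  then obtain r :: "nat \<Rightarrow> nat" where r: "strict_mono r" "\<And>k. P_fun \<alpha> (Mn (r k)) (Xn (r k)) x < c"
    using infinite_enumerate by blast
  have "\<exists>l>0. (\<integral>\<^sup>+\<omega>. ennreal (h_fun \<alpha> (l * (Xn (r k) \<omega> - x))) \<partial>Mn (r k)) < c" for k
    using r(2)[of k] unfolding P_fun_def INF_less_iff by auto
  then obtain l where l: "\<And>k. 0 < l k"
    "\<And>k. (\<integral>\<^sup>+\<omega>. ennreal (h_fun \<alpha> (l k * (Xn (r k) \<omega> - x))) \<partial>Mn (r k)) < c"
    by metis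
  \<comment> \<open>Compactness of the extended reals supplies a limit for a subsequence of the
    scales even if they are unbounded.\<close>
  obtain L :: ereal and s :: "nat \<Rightarrow> nat" where s: "strict_mono s" "((\<lambda>k. ereal (l k)) \<circ> s) \<longlonglongrightarrow> L"
    using compact_complete_linorder by metis
  define q where "q = r \<circ> s"
  have q: "strict_mono q"
    unfolding q_def using r(1) s(1) by (rule strict_mono_o)
  have lim: "(\<lambda>k. ereal (l (s k))) \<longlonglongrightarrow> L"
    using s(2) by (simp add: o_def)
  have L0: "0 \<le> L"
    using lim by (rule tendsto_lowerbound) (auto intro!: always_eventually less_imp_le[OF l(1)])
  have convq: "weak_conv_m (\<lambda>k. distr (Mn (q k)) borel (Xn (q k))) (distr M borel X)"
    using conv LIMSEQ_subseq_LIMSEQ[OF _ q] unfolding weak_conv_m_def weak_conv_def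
    by (force simp: o_def)
  \<comment> \<open>Common to both cases for \<open>L\<close>: any Borel minorant of the limiting
    integrands has expectation at most \<open>c\<close>.\<close>
  have fatou: "(\<integral>\<^sup>+\<omega>. f (X \<omega>) \<partial>M) \<le> c"
    if [measurable]: "f \<in> borel_measurable borel"
      and le: "\<And>yn y. yn \<longlonglongrightarrow> y \<Longrightarrow> f y \<le> liminf (\<lambda>k. ennreal (h_fun \<alpha> (l (s k) * (yn k - x))))"
    for f
  proof -
    have "(\<integral>\<^sup>+\<omega>. f (X \<omega>) \<partial>M) \<le>
        liminf (\<lambda>k. \<integral>\<^sup>+\<omega>. ennreal (h_fun \<alpha> (l (s k) * (Xn (q k) \<omega> - x))) \<partial>Mn (q k))"
      by (rule weak_conv_m_Fatou[OF M(1) M(3) X Xn convq that(1) _ le]) measurable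
    also have "\<dots> \<le> c"
      using l(2)[of "s _"] by (intro Liminf_le always_eventually) (auto simp: q_def intro: less_imp_le)
    finally show ?thesis .
  qed
  show False
  proof (cases L)
    case PInf
    have top: "filterlim (\<lambda>k. l (s k)) at_top sequentially"
      using lim PInf by (simp add: tendsto_PInfty_eq_at_top)
    \<comment> \<open>With diverging scales the integrand blows up wherever the limit exceeds
      \<open>x\<close>. As this event has positive probability, \<open>c\<close> would be
      infinite.\<close>
    have "(\<integral>\<^sup>+\<omega>. \<infinity> * indicator {x<..} (X \<omega>) \<partial>M) \<le> c"
    proof (rule fatou)
      fix yn y assume yn: "yn \<longlonglongrightarrow> (y::real)"
      show "\<infinity> * indicator {x<..} y \<le> liminf (\<lambda>k. ennreal (h_fun \<alpha> (l (s k) * (yn k - x))))"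
      proof (cases "x < y")
        case True
        have "filterlim (\<lambda>k. l (s k) * (yn k - x)) at_top sequentially"
          using True filterlim_tendsto_pos_mult_at_top[OF tendsto_diff[OF yn tendsto_const] _ top, of x]
          by (simp add: mult.commute)
        then have "filterlim (\<lambda>k. h_fun \<alpha> (l (s k) * (yn k - x))) at_top sequentially"
          by (rule filterlim_compose[OF filterlim_h_fun_at_top[OF \<alpha>]])
        then have "(\<lambda>k. ennreal (h_fun \<alpha> (l (s k) * (yn k - x)))) \<longlonglongrightarrow> \<infinity>"
          by (simp add: ennreal_tendsto_top_eq_at_top)
        then show ?thesis
          using lim_imp_Liminf[of sequentially] by fastforce
      qed simp
    qed measurable
    moreover have "(\<integral>\<^sup>+\<omega>. \<infinity> * indicator {x<..} (X \<omega>) \<partial>M) = \<infinity> * emeasure M {\<omega> \<in> space M. x < X \<omega>}"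
      by (subst nn_integral_cmult_indicator[symmetric]) (auto intro!: nn_integral_cong simp: indicator_def)
    moreover have "emeasure M {\<omega> \<in> space M. x < X \<omega>} \<noteq> 0"
      using prob_greater_pos[OF M(1) X x] by (simp add: emeasure_eq_measure)
    ultimately show False
      using c(2) by (simp add: ennreal_top_mult top_unique)
  next
    case (real m)
    then have m: "0 \<le> m" "(\<lambda>k. l (s k)) \<longlonglongrightarrow> m"
      using L0 lim by auto
    have "(\<integral>\<^sup>+\<omega>. ennreal (h_fun \<alpha> (m * (X \<omega> - x))) \<partial>M) \<le> c"
    proof (rule fatou)
      fix yn y assume yn: "yn \<longlonglongrightarrow> (y::real)"
      have "(\<lambda>k. ennreal (h_fun \<alpha> (l (s k) * (yn k - x)))) \<longlonglongrightarrow> ennreal (h_fun \<alpha> (m * (y - x)))"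
        by (intro tendsto_ennrealI tendsto_h_fun \<alpha> tendsto_mult tendsto_diff m(2) yn tendsto_const)
      then show "ennreal (h_fun \<alpha> (m * (y - x))) \<le> liminf (\<lambda>k. ennreal (h_fun \<alpha> (l (s k) * (yn k - x))))"
        by (simp add: lim_imp_Liminf)
    qed measurable
    \<comment> \<open>The limit scale 0 is not admissible in the infimum; there the expectation is
      1, and the general bound by 1 takes over.\<close>
    moreover have "P_fun \<alpha> M X x \<le> (\<integral>\<^sup>+\<omega>. ennreal (h_fun \<alpha> (m * (X \<omega> - x))) \<partial>M)"
    proof (cases "m = 0")
      case True
      then show ?thesis
        using P_fun_le_1[OF \<alpha> M(1,2)] by (simp add: h_fun_0[OF \<alpha>] emeasure_space_1)
    next
      case False
      then show ?thesis using m(1) by (intro P_fun_le) simp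
    qed
    ultimately show False using c(2) by simp
  next
    case MInf
    then show False using L0 by simp
  qed
qed

theorem proposition1p5:
  fixes \<alpha> :: ereal
    and M :: "'a measure" and X :: "'a \<Rightarrow> real"
    and Mn :: "nat \<Rightarrow> 'b measure" and Xn :: "nat \<Rightarrow> 'b \<Rightarrow> real"
  assumes "0 < \<alpha>"
    and "prob_space M" and "X \<in> X_class \<alpha> M"
    and "\<And>n. prob_space (Mn n)" and "\<And>n. Xn n \<in> X_class \<alpha> (Mn n)"
    and "weak_conv_m (\<lambda>n. distr (Mn n) borel (Xn n)) (distr M borel X)"
    and "unif_int_cond \<alpha> M X Mn Xn"
  shows "(\<forall>x::real. ereal x \<noteq> x_star M X \<longrightarrow>
             (\<lambda>n. P_fun \<alpha> (Mn n) (Xn n) x) \<longlonglongrightarrow> P_fun \<alpha> M X x) \<and>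
         (\<forall>x::real. isCont (P_fun \<alpha> M X) x \<longrightarrow>
             (\<lambda>n. P_fun \<alpha> (Mn n) (Xn n) x) \<longlonglongrightarrow> P_fun \<alpha> M X x) \<and>
         (\<forall>x::real. ereal x = x_star M X \<longrightarrow>
             (\<lambda>n. measure (Mn n) {\<omega> \<in> space (Mn n). Xn n \<omega> = x})
               \<longlonglongrightarrow> measure M {\<omega> \<in> space M. X \<omega> = x} \<longrightarrow>
             (\<lambda>n. P_fun \<alpha> (Mn n) (Xn n) x) \<longlonglongrightarrow> P_fun \<alpha> M X x) \<and>
         (\<forall>x::real. ereal x = x_star M X \<longrightarrow>
             measure M {\<omega> \<in> space M. X \<omega> = x} = 0 \<longrightarrow>
             (\<lambda>n. P_fun \<alpha> (Mn n) (Xn n) x) \<longlonglongrightarrow> P_fun \<alpha> M X x)"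
proof -
  note \<alpha> = assms(1) and M = assms(2) and Mn = assms(4)
  have X: "X \<in> borel_measurable M" and Xn: "\<And>n. Xn n \<in> borel_measurable (Mn n)"
    using assms(3,5) by (auto simp: X_class_def)
  let ?P = "P_fun \<alpha> M X" and ?Pn = "\<lambda>n. P_fun \<alpha> (Mn n) (Xn n)"
  let ?p = "\<lambda>x. measure M {\<omega> \<in> space M. X \<omega> = x}"
  have limsup: "limsup (\<lambda>n. ?Pn n x) \<le> ?P x" for x
    by (rule limsup_P_fun_le[OF \<alpha> M assms(3) Mn Xn assms(6,7)])
  \<comment> \<open>The upper bound holds at every \<open>x\<close>, so each remaining claim reduces
    to a lower bound on the limit inferior.\<close>
  have convI: "(\<lambda>n. ?Pn n x) \<longlonglongrightarrow> ?P x" if "?P x \<le> liminf (\<lambda>n. ?Pn n x)" for x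
    using that limsup[of x] Liminf_le_Limsup[of sequentially "\<lambda>n. ?Pn n x"]
    by (auto simp: tendsto_iff_Liminf_eq_Limsup intro: antisym)
  have P_above: "?P x = ennreal (?p x)" if "x_star M X \<le> ereal x" for x
    using P_fun_ge_prob[OF \<alpha> M X] P_fun_le_prob[OF \<alpha> M X AE_le_x_star[OF M X that]] by (rule antisym[rotated])
  have P_beyond: "?P x = 0" if x: "x_star M X < ereal x" for x
  proof -
    \<comment> \<open>A point strictly between turns the almost sure bound \<open>X \<le> b\<close>
      into \<open>X \<noteq> x\<close>, so there is no atom at \<open>x\<close>.\<close>
    obtain b where b: "x_star M X < ereal b" "b < x"
      using ereal_dense2[OF x] by auto
    have "AE \<omega> in M. X \<omega> \<noteq> x"
      using AE_le_x_star[OF M X less_imp_le[OF b(1)]] by eventually_elim (use b in auto)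
    then have "?p x = 0"
      using X by (subst (asm) AE_iff_measurable[OF _ refl]) (auto simp: measure_def)
    then show ?thesis using P_above[of x] x by simp
  qed
  have i: "(\<lambda>n. ?Pn n x) \<longlonglongrightarrow> ?P x" if "ereal x \<noteq> x_star M X" for x
  proof (cases "ereal x < x_star M X")
    case True
    then show ?thesis
      by (intro convI liminf_P_fun_ge[OF \<alpha> M assms(3) Mn Xn assms(6)])
  next
    case False
    with that have "x_star M X < ereal x" by simp
    then show ?thesis by (intro convI) (simp add: P_beyond)
  qed
  \<comment> \<open>Only \<open>x = x_star\<close> is new. To its right \<open>?P\<close> vanishes,
    so continuity forces \<open>?P x = 0\<close> and the lower bound becomes trivial.\<close>
  have cont: "(\<lambda>n. ?Pn n x) \<longlonglongrightarrow> ?P x" if "isCont ?P x" for x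
  proof (cases "ereal x = x_star M X")
    case True
    have "(\<lambda>k. x + inverse (real (Suc k))) \<longlonglongrightarrow> x"
      using tendsto_add[OF tendsto_const LIMSEQ_inverse_real_of_nat, of x] by simp
    then have "(\<lambda>k. ?P (x + inverse (real (Suc k)))) \<longlonglongrightarrow> ?P x"
      by (rule isCont_tendsto_compose[OF that])
    moreover have "?P (x + inverse (real (Suc k))) = 0" for k
      by (rule P_beyond) (simp add: True[symmetric])
    ultimately have "?P x = 0"
      by (simp add: LIMSEQ_const_iff)
    then show ?thesis by (intro convI) simp
  qed (rule i)
  have ii: "(\<lambda>n. ?Pn n x) \<longlonglongrightarrow> ?P x"
    if x: "ereal x = x_star M X"
      and p: "(\<lambda>n. measure (Mn n) {\<omega> \<in> space (Mn n). Xn n \<omega> = x}) \<longlonglongrightarrow> ?p x" for x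
  proof (rule convI)
    \<comment> \<open>At the right end point \<open>?P x\<close> is the mass of the atom, which is
      the limit of the atoms of the \<open>Xn n\<close>; these lie below
      \<open>?Pn n x\<close>.\<close>
    have "?P x = liminf (\<lambda>n. ennreal (measure (Mn n) {\<omega> \<in> space (Mn n). Xn n \<omega> = x}))"
      using lim_imp_Liminf[OF _ tendsto_ennrealI[OF p]] P_above[of x] x by simp
    also have "\<dots> \<le> liminf (\<lambda>n. ?Pn n x)"
      by (intro Liminf_mono always_eventually allI P_fun_ge_prob \<alpha> Mn Xn)
    finally show "?P x \<le> liminf (\<lambda>n. ?Pn n x)" .
  qed
  \<comment> \<open>Without an atom at the end point \<open>?P x\<close> is 0, a trivial lower
    bound.\<close>
  have "(\<lambda>n. ?Pn n x) \<longlonglongrightarrow> ?P x" if "ereal x = x_star M X" "?p x = 0" for x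
    using that P_above[of x] by (intro convI) simp
  with i cont ii show ?thesis by blast
qed

end
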